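(* Let $\{1,\ldots,n\}$, $n=n(T)$, be partitioned into $K_0$ (fixed number) non-empty groups $G_1,\ldots,G_{K_0}$, and let $\widehat d_{ij}=\widehat d_{ji}$ ($1\le i,j\le n$) be any real-valued statistics such that, as $T\to\infty$, \[ P\Big(\max_{1\le k\le K_0}\max_{i,j\in G_k}\widehat d_{ij}<\min_{1\le k<k'\le K_0}\min_{i\in G_k,\ j\in G_{k'}}\widehat d_{ij}\Big)\to 1. \] Let $\{\widehat G_1^{[r]},\ldots,\widehat G_{n-r}^{[r]}\}$, $r=0,\ldots,n-1$, be the partitions produced by the hierarchical agglomerative clustering algorithm (described in the context) applied to the complete-linkage dissimilarity based on $\widehat d_{ij}$. Then, as $T\to\infty$: (a) $P\big(\{\widehat G_1^{[n-K_0]},\ldots,\widehat G_{K_0}^{[n-K_0]}\}=\{G_1,\ldots,G_{K_0}\}\big)\to1$; (b) $P\big(\{\widehat G_1^{[n-K]},\ldots,\widehat G_{K}^{[n-K]}\}\text{ is a refinement of }\{G_1,\ldots,G_{K_0}\}\big)\to1$ for any $K>K_0$; (c) $P\big(\{G_1,\ldots,G_{K_0}\}\text{ is a refinement of }\{\widehat G_1^{[n-K]},\ldots,\widehat G_{K}^{[n-K]}\}\big)\to1$ for any $K<K_0$.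
   Context: Throughout $1\le K\le n$, so that the partition at step $n-K$ exists. The groups may depend on $n$. **Dissimilarity.** For $S,S'\subseteq\{1,\ldots,n\}$, $\widehat\Delta(S,S')=\max_{i\in S,\,j\in S'}\widehat d_{ij}$. **HAC algorithm.** Step $0$: $\widehat G_i^{[0]}=\{i\}$ for $1\le i\le n$. Step $r$ ($r=1,\ldots,n-1$): given the $n-(r-1)$ clusters $\widehat G_1^{[r-1]},\ldots,\widehat G_{n-(r-1)}^{[r-1]}$ of the previous step, determine a pair of clusters $\widehat G_k^{[r-1]},\widehat G_{k'}^{[r-1]}$ with $\widehat\Delta(\widehat G_k^{[r-1]},\widehat G_{k'}^{[r-1]})=\min_{1\le\ell<\ell'\le n-(r-1)}\widehat\Delta(\widehat G_\ell^{[r-1]},\widehat G_{\ell'}^{[r-1]})$ and merge them into a new cluster; this gives the partition $\{\widehat G_1^{[r]},\ldots,\widehat G_{n-r}^{[r]}\}$. **Refinement.** For partitions $\mathcal A=\{A_1,\ldots,A_r\}$, $\mathcal B=\{B_1,\ldots,B_{r'}\}$ of $\{1,\ldots,n\}$, $\mathcal A$ is a refinement of $\mathcal B$ if each $A_\ell\in\mathcal A$ is a subset of some $B_{\ell'}\in\mathcal B$. *)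

theory Defs
  imports "HOL-Probability.Probability"
begin

definition complete_linkage :: "('i \<Rightarrow> 'i \<Rightarrow> real) \<Rightarrow> 'i set \<Rightarrow> 'i set \<Rightarrow> real" where
  "complete_linkage d S S' = Max {d i j |i j. i \<in> S \<and> j \<in> S'}"

text \<open>
  Partitions are sets of clusters, since the numbering of the clusters is irrelevant. The minimum
  below therefore runs over ordered pairs of distinct clusters instead of index pairs
  \<open>\<ell> < \<ell>'\<close>, which is the same for symmetric \<open>d\<close>. The step is a relation and
  not a function: in case of ties any minimising pair may be merged.
\<close>

definition hac_step :: "('i \<Rightarrow> 'i \<Rightarrow> real) \<Rightarrow> 'i set set \<Rightarrow> 'i set set \<Rightarrow> bool" where
  "hac_step d P Q \<longleftrightarrow>
     (\<exists>A\<in>P. \<exists>B\<in>P. A \<noteq> B \<and>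
        complete_linkage d A B =
          Min {complete_linkage d C D |C D. C \<in> P \<and> D \<in> P \<and> C \<noteq> D} \<and>
        Q = insert (A \<union> B) (P - {A, B}))"

definition hac_run :: "nat \<Rightarrow> (nat \<Rightarrow> nat \<Rightarrow> real) \<Rightarrow> (nat \<Rightarrow> nat set set) \<Rightarrow> bool" where
  "hac_run n d P \<longleftrightarrow>
     P 0 = (\<lambda>i. {i}) ` {1..n} \<and> (\<forall>r\<in>{1..n - 1}. hac_step d (P (r - 1)) (P r))"

definition grouping :: "nat \<Rightarrow> nat \<Rightarrow> (nat \<Rightarrow> nat set) \<Rightarrow> bool" where
  "grouping n K G \<longleftrightarrow>
     (\<forall>k\<in>{1..K}. G k \<noteq> {}) \<and> disjoint_family_on G {1..K} \<and> (\<Union>k\<in>{1..K}. G k) = {1..n}"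

text \<open>
  The maximum within groups and the minimum between groups are taken in the extended reals, so
  that for \<open>K = 1\<close> the minimum over the empty set is \<open>\<infinity>\<close>.
\<close>

definition max_within :: "nat \<Rightarrow> (nat \<Rightarrow> nat set) \<Rightarrow> (nat \<Rightarrow> nat \<Rightarrow> real) \<Rightarrow> ereal" where
  "max_within K G d = (SUP k\<in>{1..K}. SUP i\<in>G k. SUP j\<in>G k. ereal (d i j))"

definition min_between :: "nat \<Rightarrow> (nat \<Rightarrow> nat set) \<Rightarrow> (nat \<Rightarrow> nat \<Rightarrow> real) \<Rightarrow> ereal" where
  "min_between K G d =
     (INF k\<in>{1..K}. INF k'\<in>{k<..K}. INF i\<in>G k. INF j\<in>G k'. ereal (d i j))"

end

theory Submission
  imports Defs
begin

text \<open>
  On the separation event every dissimilarity within a group is smaller than every dissimilarity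
  between groups. As long as the current partition properly refines the groups, some group
  contains two clusters; their linkage beats that of any two clusters from different groups, so
  the merge stays inside a group. Hence every partition of the run either refines the groups or is
  refined by them, and its number of clusters decides which. So the events of the theorem contain
  the separation event.
\<close>

section \<open>Refinement of partitions and numbers of blocks\<close>

text \<open>The blocks of \<open>P\<close> inside a block of \<open>Q\<close> partition it, so if
  each block of \<open>Q\<close> contained only one, that one would fill it. Then \<open>Q\<close>
  would also refine \<open>P\<close>, against antisymmetry. Such a pair is what a merge across
  groups has to compete with.\<close>

lemma refines_neq_obtain:
  assumes ref: "refines X P Q" and "P \<noteq> Q"
  obtains A B C where "A \<in> P" "B \<in> P" "A \<noteq> B" "C \<in> Q" "A \<subseteq> C" "B \<subseteq> C"
proof -
  have "\<exists>A\<in>P. \<exists>B\<in>P. A \<noteq> B \<and> (\<exists>C\<in>Q. A \<subseteq> C \<and> B \<subseteq> C)"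
  proof (rule ccontr)
    assume unique: "\<not> ?thesis"
    have "\<exists>A\<in>P. C \<subseteq> A" if C: "C \<in> Q" for C
    proof -
      have part: "partition_on C {A \<in> P. A \<subseteq> C}"
        using refines_obtains_subset[OF ref C] .
      have "C \<noteq> {}"
        using ref C by (auto simp: refines_def partition_on_def)
      then obtain A where A: "A \<in> P" "A \<subseteq> C"
        using partition_onD1[OF part] by auto
      have "{A \<in> P. A \<subseteq> C} = {A}"
        using A unique C by blast
      then show ?thesis
        using partition_onD1[OF part] A by auto
    qed
    then have "refines X Q P"
      using ref by (simp add: refines_def)
    then show False
      using refines_asym[OF ref] \<open>P \<noteq> Q\<close> by simp
  qed
  then show ?thesis
    using that by blast
qed

text \<open>Sending each block of \<open>P\<close> to the block of \<open>Q\<close> around it is a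
  surjection onto \<open>Q\<close>. With equal finite cardinalities it is injective, so no block of
  \<open>Q\<close> contains two blocks of \<open>P\<close>.\<close>

lemma refines_card:
  assumes fin: "finite X" and ref: "refines X P Q"
  shows refines_card_le: "card Q \<le> card P"
    and refines_card_eq: "card P = card Q \<Longrightarrow> P = Q"
proof -
  have P: "partition_on X P" and Q: "partition_on X Q"
    using ref by (auto simp: refines_def)
  have finP: "finite P"
    using finite_elements[OF fin P] .
  obtain f where f: "\<And>A. A \<in> P \<Longrightarrow> f A \<in> Q" "\<And>A. A \<in> P \<Longrightarrow> A \<subseteq> f A"
    using ref unfolding refines_def by metis
  \<comment> \<open>The choice of \<open>f\<close> is forced: a nonempty block cannot lie in two
    disjoint blocks.\<close>
  have f_eq: "f A = C" if "A \<in> P" "C \<in> Q" "A \<subseteq> C" for A C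
  proof (rule ccontr)
    assume "f A \<noteq> C"
    then have "f A \<inter> C = {}"
      using f(1)[OF that(1)] that(2) partition_onD2[OF Q] by (auto simp: disjoint_def)
    then show False
      using f(2)[OF that(1)] that partition_onD3[OF P] by (metis Int_greatest subset_empty)
  qed
  have img: "f ` P = Q"
  proof
    show "f ` P \<subseteq> Q" using f by auto
    show "Q \<subseteq> f ` P"
    proof
      fix C assume C: "C \<in> Q"
      have part: "partition_on C {A \<in> P. A \<subseteq> C}"
        using refines_obtains_subset[OF ref C] .
      have "C \<noteq> {}"
        using C Q by (auto simp: partition_on_def)
      then obtain A where "A \<in> P" "A \<subseteq> C"
        using partition_onD1[OF part] by auto
      then show "C \<in> f ` P"
        using f_eq C by blast
    qed
  qed
  show "card Q \<le> card P"
    using card_image_le[OF finP, of f] img by simp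
  assume "card P = card Q"
  then have inj: "inj_on f P"
    using img finP by (simp add: eq_card_imp_inj_on)
  show "P = Q"
  proof (rule ccontr)
    assume "P \<noteq> Q"
    then obtain A B C where "A \<in> P" "B \<in> P" "A \<noteq> B" "C \<in> Q" "A \<subseteq> C" "B \<subseteq> C"
      using refines_neq_obtain[OF ref] by metis
    then show False
      using f_eq inj by (metis inj_onD)
  qed
qed

section \<open>Clusters along the algorithm\<close>

lemma hac_step_refines:
  assumes P: "partition_on X P" and fin: "finite X" and step: "hac_step d P Q"
  shows "refines X P Q" and "card P = Suc (card Q)"
proof -
  obtain A B where AB: "A \<in> P" "B \<in> P" "A \<noteq> B" and Q: "Q = insert (A \<union> B) (P - {A, B})"
    using step unfolding hac_step_def by blast
  have finP: "finite P"
    using finite_elements[OF fin P] .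
  have disj: "\<And>C D. C \<in> P \<Longrightarrow> D \<in> P \<Longrightarrow> C \<noteq> D \<Longrightarrow> C \<inter> D = {}" and ne: "{} \<notin> P"
    using P by (auto simp: partition_on_def disjoint_def)
  have "partition_on X Q"
  proof (rule partition_onI)
    show "\<Union>Q = X"
      using P AB Q by (auto simp: partition_on_def)
    show "{} \<notin> Q"
      using ne AB Q by auto
    show "disjnt C D" if "C \<in> Q" "D \<in> Q" "C \<noteq> D" for C D
      using that Q AB disj unfolding disjnt_def by blast
  qed
  moreover have "\<forall>C\<in>P. \<exists>D\<in>Q. C \<subseteq> D"
    using Q by blast
  ultimately show "refines X P Q"
    using P by (simp add: refines_def)
  \<comment> \<open>The merged cluster is new, so \<open>insert\<close> really adds one to the
    cardinality. If it were in \<open>P\<close>, it would meet both \<open>A\<close> and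
    \<open>B\<close>, and disjointness would identify it with each of them.\<close>
  have "A \<union> B \<notin> P"
  proof
    assume "A \<union> B \<in> P"
    then have "A \<union> B = A" "A \<union> B = B"
      using disj[of "A \<union> B" A] disj[of "A \<union> B" B] AB ne by auto
    then show False using AB by simp
  qed
  then have "card Q = Suc (card (P - {A, B}))"
    using Q finP by simp
  moreover have "card (P - {A, B}) = card P - 2"
    using AB by (subst card_Diff_subset) auto
  \<comment> \<open>This makes the truncated subtraction \<open>card P - 2\<close> exact.\<close>
  moreover have "card {A, B} \<le> card P"
    using AB finP by (intro card_mono) auto
  ultimately show "card P = Suc (card Q)"
    using AB by simp
qed

lemma hac_run_partition:
  assumes run: "hac_run n d P" and "r \<le> n - 1"
  shows "partition_on {1..n} (P r) \<and> card (P r) = n - r"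
  using assms(2)
proof (induction r)
  case 0
  have "P 0 = (\<lambda>i. {i}) ` {1..n}"
    using run by (simp add: hac_run_def)
  then show ?case
    by (simp add: partition_on_singletons card_image)
next
  case (Suc r)
  then have IH: "partition_on {1..n} (P r)" "card (P r) = n - r"
    by auto
  have "Suc r \<in> {1..n - 1}"
    using Suc.prems by simp
  then have "hac_step d (P (Suc r - 1)) (P (Suc r))"
    using run unfolding hac_run_def by blast
  then have "hac_step d (P r) (P (Suc r))"
    by simp
  from hac_step_refines[OF IH(1) _ this] IH(2) show ?case
    by (auto simp: refines_def)
qed

section \<open>Complete linkage and merges inside the groups\<close>

lemma complete_linkage_ge:
  assumes "finite S" "finite S'" "i \<in> S" "j \<in> S'"
  shows "d i j \<le> complete_linkage d S S'"
  unfolding complete_linkage_def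
  using assms by (intro Max_ge finite_image_set2) auto

lemma complete_linkage_attained:
  assumes "finite S" "finite S'" "S \<noteq> {}" "S' \<noteq> {}"
  obtains i j where "i \<in> S" "j \<in> S'" "complete_linkage d S S' = d i j"
proof -
  have "complete_linkage d S S' \<in> {d i j |i j. i \<in> S \<and> j \<in> S'}"
    unfolding complete_linkage_def using assms by (intro Max_in finite_image_set2) auto
  then show ?thesis
    using that by blast
qed

text \<open>The assumption \<open>P \<noteq> \<G>\<close> provides two clusters in one group, and
  \<open>sep\<close> makes their linkage smaller than that of any clusters from different groups.
  The inequality is strict, so the conclusion holds for every minimising pair, however ties are
  broken.\<close>

lemma hac_step_within_groups:
  assumes fin: "finite X" and ref: "refines X P \<G>" and "P \<noteq> \<G>" and step: "hac_step d P Q"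
    and sep: "\<And>A B C i j i' j'. \<lbrakk>A \<in> \<G>; i \<in> A; j \<in> A; B \<in> \<G>; C \<in> \<G>; B \<noteq> C; i' \<in> B; j' \<in> C\<rbrakk>
                \<Longrightarrow> d i j < d i' j'"
  shows "refines X Q \<G>"
proof -
  have P: "partition_on X P"
    using ref by (simp add: refines_def)
  have finP: "finite P"
    using finite_elements[OF fin P] .
  have finite: "finite A" and nonempty: "A \<noteq> {}" if "A \<in> P" for A
    using that P fin by (auto simp: partition_on_def intro: finite_subset)
  obtain A B where AB: "A \<in> P" "B \<in> P"
    and min: "complete_linkage d A B =
          Min {complete_linkage d C D |C D. C \<in> P \<and> D \<in> P \<and> C \<noteq> D}"
    and Q: "Q = insert (A \<union> B) (P - {A, B})"
    using step unfolding hac_step_def by blast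
  obtain A' B' C where C: "A' \<in> P" "B' \<in> P" "A' \<noteq> B'" "C \<in> \<G>" "A' \<subseteq> C" "B' \<subseteq> C"
    using refines_neq_obtain[OF ref \<open>P \<noteq> \<G>\<close>] .
  \<comment> \<open>\<open>finite_image_set2\<close> takes separate conditions on \<open>C\<close>
    and \<open>D\<close>, so the condition \<open>C \<noteq> D\<close> is added afterwards by
    passing to a subset.\<close>
  have "finite {complete_linkage d C D |C D. C \<in> P \<and> D \<in> P}"
    using finP by (intro finite_image_set2) auto
  then have "finite {complete_linkage d C D |C D. C \<in> P \<and> D \<in> P \<and> C \<noteq> D}"
    by (rule rev_finite_subset) blast
  then have le: "complete_linkage d A B \<le> complete_linkage d A' B'"
    unfolding min using C by (intro Min_le) auto
  obtain A1 B1 where A1: "A1 \<in> \<G>" "A \<subseteq> A1" and B1: "B1 \<in> \<G>" "B \<subseteq> B1"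
    using ref AB unfolding refines_def by meson
  have "A1 = B1"
  proof (rule ccontr)
    assume "A1 \<noteq> B1"
    \<comment> \<open>A maximum is attained, so the linkage of \<open>A'\<close> and
      \<open>B'\<close> is a single value within the group \<open>C\<close>. The linkage of
      \<open>A\<close> and \<open>B\<close> dominates each of its values, so one arbitrary pair is
      enough there.\<close>
    obtain i j where ij: "i \<in> A'" "j \<in> B'" "complete_linkage d A' B' = d i j"
      using complete_linkage_attained finite nonempty C by metis
    obtain i' j' where ij': "i' \<in> A" "j' \<in> B"
      using nonempty AB by blast
    have "d i j < d i' j'"
      using sep[of C i j A1 B1 i' j'] C ij ij' A1 B1 \<open>A1 \<noteq> B1\<close> by blast
    also have "\<dots> \<le> complete_linkage d A B"
      using complete_linkage_ge finite AB ij' by metis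
    finally show False
      using le ij by simp
  qed
  then have "A \<union> B \<subseteq> A1"
    using A1 B1 by simp
  then have "\<forall>D\<in>Q. \<exists>E\<in>\<G>. D \<subseteq> E"
    using Q A1 ref unfolding refines_def by blast
  then show ?thesis
    using ref hac_step_refines(1)[OF P fin step] by (simp add: refines_def)
qed

text \<open>The invariant is a disjunction because the run changes sides: merges stay inside groups
  until \<open>\<G>\<close> is reached, and every later merge only coarsens.\<close>

lemma hac_run_comparable:
  assumes run: "hac_run n d P" and \<G>: "partition_on {1..n} \<G>"
    and sep: "\<And>A B C i j i' j'. \<lbrakk>A \<in> \<G>; i \<in> A; j \<in> A; B \<in> \<G>; C \<in> \<G>; B \<noteq> C; i' \<in> B; j' \<in> C\<rbrakk>
                \<Longrightarrow> d i j < d i' j'"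
    and "r \<le> n - 1"
  shows "refines {1..n} (P r) \<G> \<or> refines {1..n} \<G> (P r)"
  using assms(4)
proof (induction r)
  case 0
  have P0: "P 0 = (\<lambda>i. {i}) ` {1..n}"
    using run by (simp add: hac_run_def)
  have "\<Union>\<G> = {1..n}"
    using \<G> by (simp add: partition_on_def)
  then have "\<forall>A\<in>P 0. \<exists>B\<in>\<G>. A \<subseteq> B"
    unfolding P0 by blast
  then have "refines {1..n} (P 0) \<G>"
    using hac_run_partition[OF run 0] \<G> by (simp add: refines_def)
  then show ?case ..
next
  case (Suc r)
  have "Suc r \<in> {1..n - 1}"
    using Suc.prems by simp
  then have "hac_step d (P (Suc r - 1)) (P (Suc r))"
    using run unfolding hac_run_def by blast
  then have step: "hac_step d (P r) (P (Suc r))"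
    by simp
  have P: "partition_on {1..n} (P r)"
    using hac_run_partition[OF run] Suc.prems by simp
  have coarser: "refines {1..n} (P r) (P (Suc r))"
    using hac_step_refines(1)[OF P _ step] by simp
  have "refines {1..n} (P r) \<G> \<or> refines {1..n} \<G> (P r)"
    using Suc by simp
  \<comment> \<open>Equality with \<open>\<G>\<close> is counted as the first case by reflexivity;
    this leaves a proper refinement in the second.\<close>
  then consider "refines {1..n} \<G> (P r)" | "refines {1..n} (P r) \<G>" "P r \<noteq> \<G>"
    using refines_refl[OF \<G>] by blast
  then show ?case
  proof cases
    case 1
    then show ?thesis
      using refines_trans coarser by blast
  next
    case 2
    then show ?thesis
      using hac_step_within_groups[OF _ 2 step sep] by simp
  qed
qed

section \<open>The groups and the separation event\<close>

lemma grouping_partition: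
  assumes "grouping n K G"
  shows "partition_on {1..n} (G ` {1..K})" and "card (G ` {1..K}) = K" and "K \<le> n"
proof -
  have ne: "\<And>k. k \<in> {1..K} \<Longrightarrow> G k \<noteq> {}" and disj: "disjoint_family_on G {1..K}"
    and un: "(\<Union>k\<in>{1..K}. G k) = {1..n}"
    using assms by (auto simp: grouping_def)
  show part: "partition_on {1..n} (G ` {1..K})"
  proof (rule partition_onI)
    show "\<Union> (G ` {1..K}) = {1..n}"
      using un .
    show "{} \<notin> G ` {1..K}"
      using ne by force
    show "disjnt A B" if "A \<in> G ` {1..K}" "B \<in> G ` {1..K}" "A \<noteq> B" for A B
    proof -
      from that obtain k l where kl: "k \<in> {1..K}" "l \<in> {1..K}" "A = G k" "B = G l"
        by blast
      with that have "k \<noteq> l"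
        by blast
      then show ?thesis
        using disjoint_family_onD[OF disj kl(1,2)] kl(3,4) by (simp add: disjnt_def)
    qed
  qed
  have "inj_on G {1..K}"
  proof (rule inj_onI, rule ccontr)
    fix k k' assume "k \<in> {1..K}" "k' \<in> {1..K}" "G k = G k'" "k \<noteq> k'"
    then show False
      using disjoint_family_onD[OF disj, of k k'] ne[of k] by simp
  qed
  then show card: "card (G ` {1..K}) = K"
    by (simp add: card_image)
  \<comment> \<open>The singletons refine every partition, so comparing numbers of blocks bounds
    \<open>K\<close> by \<open>n\<close>.\<close>
  have "refines {1..n} ((\<lambda>i. {i}) ` {1..n}) (G ` {1..K})"
    using part partition_on_singletons un unfolding refines_def by blast
  from refines_card_le[OF _ this] card show "K \<le> n"
    by (simp add: card_image)
qed

text \<open>This turns the inequality of extended reals into the pointwise condition that the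
  deterministic argument uses. Since \<open>min_between\<close> sees only pairs of groups in
  increasing order, symmetry of \<open>d\<close> covers the other order.\<close>

lemma within_less_between:
  assumes G: "grouping n K G"
    and sym: "\<And>i j. i \<in> {1..n} \<Longrightarrow> j \<in> {1..n} \<Longrightarrow> d i j = d j i"
    and sep: "max_within K G d < min_between K G d"
    and mem: "k \<in> {1..K}" "i \<in> G k" "j \<in> G k"
      "l \<in> {1..K}" "l' \<in> {1..K}" "l \<noteq> l'" "i' \<in> G l" "j' \<in> G l'"
  shows "d i j < d i' j'"
proof -
  have ordered: "min_between K G d \<le> ereal (d p q)"
    if "a \<in> {1..K}" "b \<in> {a<..K}" "p \<in> G a" "q \<in> G b" for a b p q
    unfolding min_between_def
    by (rule INF_lower2[OF that(1)], rule INF_lower2[OF that(2)], rule INF_lower2[OF that(3)],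
        rule INF_lower[OF that(4)])
  have "(\<Union>k\<in>{1..K}. G k) = {1..n}"
    using G by (simp add: grouping_def)
  then have "i' \<in> {1..n}" "j' \<in> {1..n}"
    using mem by blast+
  note sym' = sym[OF this]
  have "ereal (d i j) \<le> max_within K G d"
    unfolding max_within_def
    by (rule SUP_upper2[OF mem(1)], rule SUP_upper2[OF mem(2)], rule SUP_upper[OF mem(3)])
  also note sep
  also have "min_between K G d \<le> ereal (d i' j')"
  proof (cases "l < l'")
    case True
    then show ?thesis
      using ordered[of l l' i' j'] mem by simp
  next
    case False
    then show ?thesis
      using ordered[of l' l j' i'] mem sym' by simp
  qed
  finally show ?thesis
    by simp
qed

text \<open>The partition into \<open>K\<close> clusters is comparable with the groups. If the
  comparison goes the wrong way, the numbers of blocks force equality, and reflexivity gives the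
  desired direction.\<close>

lemma hac_run_separated:
  assumes G: "grouping n K0 G"
    and sym: "\<And>i j. i \<in> {1..n} \<Longrightarrow> j \<in> {1..n} \<Longrightarrow> d i j = d j i"
    and sep: "max_within K0 G d < min_between K0 G d"
    and run: "hac_run n d P"
    and K: "1 \<le> K" "K \<le> n"
  shows "K0 \<le> K \<Longrightarrow> refines {1..n} (P (n - K)) (G ` {1..K0})"
    and "K \<le> K0 \<Longrightarrow> refines {1..n} (G ` {1..K0}) (P (n - K))"
proof -
  let ?\<G> = "G ` {1..K0}"
  note \<G> = grouping_partition[OF G]
  have "n - K \<le> n - 1"
    using K by simp
  note P = hac_run_partition[OF run this]
  have card: "card (P (n - K)) = K"
    using P K by simp
  have separated: "d i j < d i' j'"
    if "A \<in> ?\<G>" "i \<in> A" "j \<in> A" "B \<in> ?\<G>" "C \<in> ?\<G>" "B \<noteq> C" "i' \<in> B" "j' \<in> C" for A B C i j i' j'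
    using that within_less_between[OF G sym sep] by blast
  have cmp: "refines {1..n} (P (n - K)) ?\<G> \<or> refines {1..n} ?\<G> (P (n - K))"
    by (rule hac_run_comparable[OF run \<G>(1) _ \<open>n - K \<le> n - 1\<close>]) (rule separated)
  show "refines {1..n} (P (n - K)) ?\<G>" if "K0 \<le> K"
    using cmp
  proof
    \<comment> \<open>This direction gives \<open>K \<le> K0\<close>, hence \<open>K = K0\<close>,
      and then the two partitions coincide.\<close>
    assume ref: "refines {1..n} ?\<G> (P (n - K))"
    then have "?\<G> = P (n - K)"
      using refines_card[OF _ ref] that card \<G>(2) by simp
    then show ?thesis
      using refines_refl[OF \<G>(1)] by simp
  qed
  show "refines {1..n} ?\<G> (P (n - K))" if "K \<le> K0"
    using cmp
  proof
    assume ref: "refines {1..n} (P (n - K)) ?\<G>"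
    then have "P (n - K) = ?\<G>"
      using refines_card[OF _ ref] that card \<G>(2) by simp
    then show ?thesis
      using refines_refl[OF \<G>(1)] by simp
  qed
qed

section \<open>Passage to probabilities\<close>

text \<open>The probability of the larger event is squeezed between that of the smaller one and 1.
  Measurability is asked of the larger event because a nonmeasurable set would receive measure 0.
  Eventual conditions suffice for a limit and allow for \<open>K \<le> n T\<close> holding only for
  large \<open>T\<close>.\<close>

lemma prob_tendsto_1_mono:
  assumes prob: "\<And>T. prob_space (M T)"
    and lim: "(\<lambda>T. \<P>(\<omega> in M T. A T \<omega>)) \<longlonglongrightarrow> 1"
    and meas: "\<forall>\<^sub>F T in sequentially. {\<omega> \<in> space (M T). B T \<omega>} \<in> sets (M T)"
    and imp: "\<forall>\<^sub>F T in sequentially. \<forall>\<omega>\<in>space (M T). A T \<omega> \<longrightarrow> B T \<omega>"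
  shows "(\<lambda>T. \<P>(\<omega> in M T. B T \<omega>)) \<longlonglongrightarrow> 1"
proof (rule tendsto_sandwich[OF _ _ lim tendsto_const])
  show "\<forall>\<^sub>F T in sequentially. \<P>(\<omega> in M T. A T \<omega>) \<le> \<P>(\<omega> in M T. B T \<omega>)"
    using meas imp
  proof eventually_elim
    case (elim T)
    interpret prob_space "M T" by (rule prob)
    show ?case
      using elim by (intro finite_measure_mono) auto
  qed
  show "\<forall>\<^sub>F T in sequentially. \<P>(\<omega> in M T. B T \<omega>) \<le> 1"
    using prob by (simp add: prob_space.prob_le_1)
qed

theorem theorem4p1:
  fixes M :: "nat \<Rightarrow> 'w measure"
    and n :: "nat \<Rightarrow> nat"
    and K0 :: nat
    and G :: "nat \<Rightarrow> nat \<Rightarrow> nat set"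
    and dhat :: "nat \<Rightarrow> nat \<Rightarrow> nat \<Rightarrow> 'w \<Rightarrow> real"
    and Ghat :: "nat \<Rightarrow> nat \<Rightarrow> 'w \<Rightarrow> nat set set"
  assumes prob: "\<And>T. prob_space (M T)"
    and K0: "K0 \<ge> 1"
    and groups: "\<And>T. grouping (n T) K0 (G T)"
    and dhat_rv: "\<And>T i j. i \<in> {1..n T} \<Longrightarrow> j \<in> {1..n T} \<Longrightarrow>
                    dhat T i j \<in> borel_measurable (M T)"
    and dhat_sym: "\<And>T i j \<omega>. i \<in> {1..n T} \<Longrightarrow> j \<in> {1..n T} \<Longrightarrow> \<omega> \<in> space (M T) \<Longrightarrow>
                    dhat T i j \<omega> = dhat T j i \<omega>"
    and separation: "(\<lambda>T. \<P>(\<omega> in M T. max_within K0 (G T) (\<lambda>i j. dhat T i j \<omega>)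
                              < min_between K0 (G T) (\<lambda>i j. dhat T i j \<omega>))) \<longlonglongrightarrow> 1"
    and Ghat_hac: "\<And>T \<omega>. \<omega> \<in> space (M T) \<Longrightarrow>
                    hac_run (n T) (\<lambda>i j. dhat T i j \<omega>) (\<lambda>r. Ghat T r \<omega>)"
    and Ghat_rv: "\<And>T r. r \<in> {0..n T - 1} \<Longrightarrow> Ghat T r \<in> M T \<rightarrow>\<^sub>M count_space UNIV"
  shows "((\<lambda>T. \<P>(\<omega> in M T. Ghat T (n T - K0) \<omega> = G T ` {1..K0})) \<longlonglongrightarrow> 1)
    \<and> (\<forall>K>K0. (\<forall>\<^sub>F T in sequentially. K \<le> n T) \<longrightarrow>
           (\<lambda>T. \<P>(\<omega> in M T. refines {1..n T} (Ghat T (n T - K) \<omega>) (G T ` {1..K0}))) \<longlonglongrightarrow> 1)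
    \<and> (\<forall>K<K0. 1 \<le> K \<longrightarrow>
           (\<lambda>T. \<P>(\<omega> in M T. refines {1..n T} (G T ` {1..K0}) (Ghat T (n T - K) \<omega>))) \<longlonglongrightarrow> 1)"
proof -
  \<comment> \<open>The discrete target space in \<open>Ghat_rv\<close> makes every predicate
    \<open>Q\<close> measurable; \<open>1 \<le> K\<close> keeps \<open>n T - K\<close> in the range
    of valid steps.\<close>
  have meas: "{\<omega> \<in> space (M T). Q (Ghat T (n T - K) \<omega>)} \<in> sets (M T)" if "1 \<le> K" for T K Q
    using measurable_sets[OF Ghat_rv, of "n T - K" T "{P. Q P}"] that
    by (simp add: vimage_def Int_def conj_commute)
  have finer: "refines {1..n T} (Ghat T (n T - K) \<omega>) (G T ` {1..K0})"
    if "\<omega> \<in> space (M T)" "1 \<le> K" "K \<le> n T" "K0 \<le> K"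
      "max_within K0 (G T) (\<lambda>i j. dhat T i j \<omega>) < min_between K0 (G T) (\<lambda>i j. dhat T i j \<omega>)"
    for T \<omega> K
    using hac_run_separated(1)[OF groups _ that(5) Ghat_hac[OF that(1)] that(2-4)]
      dhat_sym that(1) by blast
  have coarser: "refines {1..n T} (G T ` {1..K0}) (Ghat T (n T - K) \<omega>)"
    if "\<omega> \<in> space (M T)" "1 \<le> K" "K \<le> n T" "K \<le> K0"
      "max_within K0 (G T) (\<lambda>i j. dhat T i j \<omega>) < min_between K0 (G T) (\<lambda>i j. dhat T i j \<omega>)"
    for T \<omega> K
    using hac_run_separated(2)[OF groups _ that(5) Ghat_hac[OF that(1)] that(2-4)]
      dhat_sym that(1) by blast
  have K0_le: "K0 \<le> n T" for T
    using grouping_partition(3)[OF groups] .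
  show ?thesis
  proof (intro conjI allI impI)
    show "(\<lambda>T. \<P>(\<omega> in M T. Ghat T (n T - K0) \<omega> = G T ` {1..K0})) \<longlonglongrightarrow> 1"
      \<comment> \<open>At \<open>K = K0\<close> both refinements hold on the separation event, and
        antisymmetry gives equality.\<close>
      by (rule prob_tendsto_1_mono[OF prob separation])
        (use meas[OF K0] finer[OF _ K0 K0_le] coarser[OF _ K0 K0_le] in
          \<open>auto intro!: always_eventually refines_asym\<close>)
  next
    fix K assume K: "K0 < K" and ev: "\<forall>\<^sub>F T in sequentially. K \<le> n T"
    show "(\<lambda>T. \<P>(\<omega> in M T. refines {1..n T} (Ghat T (n T - K) \<omega>) (G T ` {1..K0}))) \<longlonglongrightarrow> 1"
    proof (rule prob_tendsto_1_mono[OF prob separation])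
      show "\<forall>\<^sub>F T in sequentially.
          {\<omega> \<in> space (M T). refines {1..n T} (Ghat T (n T - K) \<omega>) (G T ` {1..K0})} \<in> sets (M T)"
        using meas K by (intro always_eventually allI) simp
      show "\<forall>\<^sub>F T in sequentially. \<forall>\<omega>\<in>space (M T).
          max_within K0 (G T) (\<lambda>i j. dhat T i j \<omega>) < min_between K0 (G T) (\<lambda>i j. dhat T i j \<omega>) \<longrightarrow>
          refines {1..n T} (Ghat T (n T - K) \<omega>) (G T ` {1..K0})"
        \<comment> \<open>Here \<open>K\<close> may exceed \<open>n T\<close> for some
          \<open>T\<close>, and only the remaining \<open>T\<close> satisfy the condition of
          \<open>finer\<close>.\<close>
        using ev by eventually_elim (use K finer in auto)
    qed
  next
    fix K assume K: "K < K0" "1 \<le> K"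
    show "(\<lambda>T. \<P>(\<omega> in M T. refines {1..n T} (G T ` {1..K0}) (Ghat T (n T - K) \<omega>))) \<longlonglongrightarrow> 1"
    proof (rule prob_tendsto_1_mono[OF prob separation])
      show "\<forall>\<^sub>F T in sequentially.
          {\<omega> \<in> space (M T). refines {1..n T} (G T ` {1..K0}) (Ghat T (n T - K) \<omega>)} \<in> sets (M T)"
        using meas K by (intro always_eventually allI) simp
      have "K \<le> n T" for T
        using K K0_le[of T] by simp
      then show "\<forall>\<^sub>F T in sequentially. \<forall>\<omega>\<in>space (M T).
          max_within K0 (G T) (\<lambda>i j. dhat T i j \<omega>) < min_between K0 (G T) (\<lambda>i j. dhat T i j \<omega>) \<longrightarrow>
          refines {1..n T} (G T ` {1..K0}) (Ghat T (n T - K) \<omega>)"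
        using K coarser by (intro always_eventually) auto
    qed
  qed
qed

end
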